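(* Let $m\ge 1$ be an integer and let $\underline{c}=(c_1,c_2,c_3,\ldots)\in\Sigma_{m+1}$. Then $\dim_H(M_{\underline{c}})=\dim_H(M_{\underline{c}}')$.
   Context: $\Sigma_{m+1}=\{0,1,\ldots,m\}^{\mathbb{N}}$ (sequences $\underline{x}=(x_1,x_2,\ldots)$) is equipped with the shift $(\sigma(\underline{x}))_i=x_{i+1}$, the lexicographic order $<$, and the metric $d(\underline{a},\underline{b})=\sum_{i\ge1}|a_i-b_i|/(m+1)^i$, with respect to which Hausdorff dimension $\dim_H$ is taken. For $\underline{c}\in\Sigma_{m+1}$, $$M_{\underline{c}}'=\{\underline{x}\in\Sigma_{m+1}:\ \sigma^n(\underline{x})\le\underline{c},\ \forall n\ge0\},$$ $$M_{\underline{c}}=\{\underline{x}\in\Sigma_{m+1}:\ \sigma^n(\underline{x})<\underline{x}\le\underline{c},\ \forall n>0\}.$$ *)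

theory Defs
  imports "HOL-Analysis.Analysis" "HOL-Library.Fun_Lexorder"
begin

section \<open>Hausdorff measure and dimension in a metric space\<close>

context Metric_space
begin

definition diam :: "'a set \<Rightarrow> ennreal" where
  "diam U = (SUP x\<in>U. SUP y\<in>U. ennreal (d x y))"

text \<open>The contribution \<open>(diam U)\<^sup>s\<close> of a set of finite diameter to an \<open>s\<close>-dimensional covering sum.
  The cases are split because \<^term>\<open>0 powr 0 = (0::real)\<close>: for \<open>s = 0\<close> every nonempty set must
  count \<open>1\<close> (counting measure), and the empty set counts \<open>0\<close>.\<close>

definition gauge_term :: "real \<Rightarrow> 'a set \<Rightarrow> ennreal" where
  "gauge_term s U =
     (if U = {} then 0 else if s = 0 then 1 else ennreal (enn2real (diam U) powr s))"

text \<open>Countable covers of \<open>A\<close> by sets of diameter at most \<open>\<delta>\<close>; finite covers are included by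
  padding with empty sets.\<close>

definition delta_covers :: "real \<Rightarrow> 'a set \<Rightarrow> (nat \<Rightarrow> 'a set) set" where
  "delta_covers \<delta> A =
     {U. (\<forall>i. U i \<subseteq> M \<and> diam (U i) \<le> ennreal \<delta>) \<and> A \<subseteq> (\<Union>i. U i)}"

definition hausdorff_premeasure :: "real \<Rightarrow> real \<Rightarrow> 'a set \<Rightarrow> ennreal" where
  "hausdorff_premeasure s \<delta> A = (INF U\<in>delta_covers \<delta> A. \<Sum>i. gauge_term s (U i))"

definition hausdorff_measure :: "real \<Rightarrow> 'a set \<Rightarrow> ennreal" where
  "hausdorff_measure s A = (SUP \<delta>\<in>{0<..}. hausdorff_premeasure s \<delta> A)"

text \<open>With this definition the empty set has dimension \<open>0\<close>, and a set with no \<open>s\<close> as below has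
  dimension \<open>\<infinity>\<close>.\<close>

definition hausdorff_dim :: "'a set \<Rightarrow> ennreal" where
  "hausdorff_dim A = Inf {ennreal s | s. 0 \<le> s \<and> hausdorff_measure s A = 0}"

end

section \<open>The one-sided shift on \<open>m + 1\<close> symbols\<close>

text \<open>Sequences are indexed from \<open>0\<close>: the value \<^term>\<open>x i\<close> is the usual \<open>x\<^bsub>i+1\<^esub>\<close>.\<close>

type_synonym symseq = "nat \<Rightarrow> nat"

definition Seqs :: "nat \<Rightarrow> symseq set" where
  "Seqs m = (UNIV \<rightarrow> {0..m})"

definition shift :: "symseq \<Rightarrow> symseq" where
  "shift x = (\<lambda>i. x (Suc i))"

text \<open>The strict lexicographic order is \<^const>\<open>less_fun\<close>; this is the corresponding weak order.\<close>

definition lex_le :: "symseq \<Rightarrow> symseq \<Rightarrow> bool" where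
  "lex_le x y \<longleftrightarrow> x = y \<or> less_fun x y"

text \<open>The exponent is \<open>i + 1\<close> because of the index shift. The unordered sum is used because it
  has value \<open>0\<close> on non-summable families (unbounded sequences, outside \<^const>\<open>Seqs\<close>), as the global
  nonnegativity axiom of \<^locale>\<open>Metric_space\<close> requires; on \<^const>\<open>Seqs\<close> it is the ordinary series,
  see \<open>seq_dist_sums\<close>.\<close>

definition seq_dist :: "nat \<Rightarrow> symseq \<Rightarrow> symseq \<Rightarrow> real" where
  "seq_dist m a b = (\<Sum>\<^sub>\<infinity>i. \<bar>real (a i) - real (b i)\<bar> / (real m + 1) ^ Suc i)"

lemma seq_dist_summable:
  assumes "1 \<le> m" "a \<in> Seqs m" "b \<in> Seqs m"
  shows "summable (\<lambda>i. \<bar>real (a i) - real (b i)\<bar> / (real m + 1) ^ Suc i)"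
proof (rule summable_comparison_test')
  show "summable (\<lambda>i. real m * (1 / (real m + 1)) ^ Suc i)"
    using assms(1) by (intro summable_mult) (simp add: summable_Suc_iff del: power_Suc)
  fix i :: nat
  have "a i \<le> m" "b i \<le> m"
    using assms by (auto simp: Seqs_def Pi_iff)
  then have "\<bar>real (a i) - real (b i)\<bar> \<le> real m"
    by linarith
  then show "norm (\<bar>real (a i) - real (b i)\<bar> / (real m + 1) ^ Suc i)
      \<le> real m * (1 / (real m + 1)) ^ Suc i"
    by (simp add: power_one_over divide_simps mult_right_mono del: power_Suc)
qed

lemma seq_dist_sums:
  assumes "1 \<le> m" "a \<in> Seqs m" "b \<in> Seqs m"
  shows "(\<lambda>i. \<bar>real (a i) - real (b i)\<bar> / (real m + 1) ^ Suc i) sums seq_dist m a b"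
proof -
  let ?f = "\<lambda>i. \<bar>real (a i) - real (b i)\<bar> / (real m + 1) ^ Suc i"
  have "(?f has_sum suminf ?f) UNIV"
    using seq_dist_summable[OF assms]
    by (intro norm_summable_imp_has_sum) (simp_all add: summable_sums)
  then have "seq_dist m a b = suminf ?f"
    unfolding seq_dist_def by (rule infsumI)
  then show ?thesis
    using seq_dist_summable[OF assms] by (simp add: summable_sums)
qed

lemma Metric_space_Seqs:
  assumes m: "1 \<le> m"
  shows "Metric_space (Seqs m) (seq_dist m)"
proof
  fix x y :: symseq
  show "0 \<le> seq_dist m x y"
    unfolding seq_dist_def by (intro infsum_nonneg) simp
  show "seq_dist m x y = seq_dist m y x"
    unfolding seq_dist_def by (simp add: abs_minus_commute)
next
  fix x y assume x: "x \<in> Seqs m" and y: "y \<in> Seqs m"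
  let ?f = "\<lambda>i. \<bar>real (x i) - real (y i)\<bar> / (real m + 1) ^ Suc i"
  have "suminf ?f = 0 \<longleftrightarrow> (\<forall>i. ?f i = 0)"
    by (rule suminf_eq_zero_iff[OF seq_dist_summable[OF m x y]]) simp
  then show "seq_dist m x y = 0 \<longleftrightarrow> x = y"
    using seq_dist_sums[OF m x y] by (auto simp: sums_iff fun_eq_iff)
next
  fix x y z assume x: "x \<in> Seqs m" and y: "y \<in> Seqs m" and z: "z \<in> Seqs m"
  show "seq_dist m x z \<le> seq_dist m x y + seq_dist m y z"
    by (rule sums_le[OF _ seq_dist_sums[OF m x z]
          sums_add[OF seq_dist_sums[OF m x y] seq_dist_sums[OF m y z]]])
      (simp add: add_divide_distrib[symmetric] divide_right_mono)
qed

definition dimH :: "nat \<Rightarrow> symseq set \<Rightarrow> ennreal" where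
  "dimH m = Metric_space.hausdorff_dim (Seqs m) (seq_dist m)"

definition M_prime :: "nat \<Rightarrow> symseq \<Rightarrow> symseq set" where
  "M_prime m c = {x \<in> Seqs m. \<forall>n. lex_le ((shift ^^ n) x) c}"

definition M_strict :: "nat \<Rightarrow> symseq \<Rightarrow> symseq set" where
  "M_strict m c = {x \<in> Seqs m. \<forall>n>0. less_fun ((shift ^^ n) x) x \<and> lex_le x c}"

end

theory Submission
  imports Defs
begin

text \<open>
  The inclusion of \<^term>\<open>M_strict m c\<close> in \<^term>\<open>M_prime m c\<close> gives one inequality. For the other,
  discard from \<^term>\<open>M_prime m c\<close> the countably many sequences that have \<open>c\<close> among their shifts;
  there remains the set \<open>E\<close> of sequences all of whose shifts are strictly below \<open>c\<close>. It suffices to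
  map \<open>E\<close> into \<^term>\<open>M_strict m c\<close> in such a way that only little dimension is lost.

  The set \<open>E\<close> is closed under shifts and under lowering individual symbols. For a block length
  \<open>N\<close>, let \<open>thin N x\<close> arise from \<open>x\<close> by replacing with \<open>0\<close> the first nonzero symbol of each block
  \<open>N b, \<dots>, N b + N - 1\<close>. Two facts make this map useful.

  \<^item> It loses little information. A block of \<open>x\<close> is determined by the same block of \<open>thin N x\<close>, the
    place of the change and the symbol erased there. So at most \<open>(N (m + 1))\<^sup>J\<close> words of length
    \<open>N J\<close> have the same image, and their exponential growth rate, \<open>log (N (m + 1)) / N\<close>, tends to
    \<open>0\<close> as \<open>N\<close> grows.

  \<^item> It creates a gap at the top. Let \<open>e\<close> be the lexicographic supremum of \<open>E\<close>. Unless \<open>E\<close>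
    contains at most the zero sequence, \<open>e\<close> has infinitely many nonzero symbols
    (\<open>sup_infinite_support\<close>). If a long piece of \<open>thin N x\<close> were a prefix of \<open>e\<close>, then so would be
    the corresponding piece of \<open>x\<close>, which is pointwise larger but still cannot exceed \<open>e\<close>. The map
    would have changed nothing there, which is possible only on blocks of zeros, and \<open>e\<close> has
    nonzero symbols. Hence all pieces of \<open>thin N x\<close> of some fixed length are strictly below the
    prefix of \<open>e\<close> of that length (\<open>thin_shifts_below_sup\<close>).

  Now put a long prefix of \<open>e\<close> ending in a nonzero symbol, followed by many zeros, in front of
  \<open>thin N x\<close>. By the gap, the resulting sequence dominates all its shifts strictly, and the zeros
  keep it below \<open>c\<close>; it lies in \<^term>\<open>M_strict m c\<close> (\<open>thin_behind_prefix_in_M_strict\<close>). A cover of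
  \<^term>\<open>M_strict m c\<close> pulls back along this map to a cover of \<open>E\<close>
  (\<open>null_via_thinning_behind_prefix\<close>): if \<^term>\<open>M_strict m c\<close> is null for the exponent \<open>s\<close>, then \<open>E\<close>
  is null for every \<open>t > s\<close>, by choosing \<open>N\<close> large in terms of \<open>t - s\<close>.
\<close>

section \<open>Hausdorff content\<close>

context Metric_space
begin

lemma hausdorff_premeasure_mono:
  assumes "A \<subseteq> B"
  shows "hausdorff_premeasure s \<delta> A \<le> hausdorff_premeasure s \<delta> B"
  unfolding hausdorff_premeasure_def
  by (rule INF_superset_mono) (use assms in \<open>auto simp: delta_covers_def\<close>)

lemma hausdorff_premeasure_le_suminf:
  assumes "U \<in> delta_covers \<delta> A"
  shows "hausdorff_premeasure s \<delta> A \<le> (\<Sum>i. gauge_term s (U i))"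
  unfolding hausdorff_premeasure_def using assms by (rule INF_lower)

lemma hausdorff_premeasure_le_gauge_term:
  assumes "U \<subseteq> M" "diam U \<le> ennreal \<delta>"
  shows "hausdorff_premeasure s \<delta> U \<le> gauge_term s U"
proof -
  let ?V = "\<lambda>i::nat. if i = 0 then U else {}"
  have "?V \<in> delta_covers \<delta> U"
    using assms by (auto simp: delta_covers_def diam_def)
  then have "hausdorff_premeasure s \<delta> U \<le> (\<Sum>i. gauge_term s (?V i))"
    by (rule hausdorff_premeasure_le_suminf)
  also have "\<dots> = (\<Sum>i\<in>{0}. gauge_term s (?V i))"
    by (rule suminf_finite) (auto simp: gauge_term_def)
  finally show ?thesis by simp
qed

lemma hausdorff_premeasure_empty [simp]: "hausdorff_premeasure s \<delta> {} = 0"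
  using hausdorff_premeasure_le_gauge_term[of "{}" \<delta> s] by (simp add: diam_def gauge_term_def)

lemma hausdorff_premeasure_UN_le:
  "hausdorff_premeasure s \<delta> (\<Union>i. A i) \<le> (\<Sum>i. hausdorff_premeasure s \<delta> (A i))"
  for A :: "nat \<Rightarrow> 'a set"
proof (rule ennreal_le_epsilon)
  fix e :: real
  let ?h = "\<lambda>i. hausdorff_premeasure s \<delta> (A i)"
  let ?e = "\<lambda>i. ennreal (e * (1/2) ^ Suc i)"
  assume fin: "(\<Sum>i. ?h i) < top" and e: "0 < e"
  have "\<exists>U\<in>delta_covers \<delta> (A i). (\<Sum>j. gauge_term s (U j)) < ?h i + ?e i" for i
  proof -
    have "?h i < top"
      using fin by (rule ennreal_suminf_lessD)
    moreover have "0 < ?e i"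
      using e by simp
    ultimately have "?h i < ?h i + ?e i"
      by (simp add: ennreal_add_left_cancel_less)
    then show ?thesis
      by (subst (asm) hausdorff_premeasure_def) (simp only: INF_less_iff)
  qed
  then obtain U where U: "\<And>i. U i \<in> delta_covers \<delta> (A i)"
    and sum_U: "\<And>i. (\<Sum>j. gauge_term s (U i j)) < ?h i + ?e i"
    by metis
  \<comment> \<open>Merge the covers of the individual sets into one sequence by the pairing bijection.\<close>
  define V where "V k = (case prod_decode k of (i, j) \<Rightarrow> U i j)" for k
  have V_encode: "V (prod_encode (i, j)) = U i j" for i j
    by (simp add: V_def)
  have "V \<in> delta_covers \<delta> (\<Union>i. A i)"
  proof -
    have "V k \<subseteq> M \<and> diam (V k) \<le> ennreal \<delta>" for k
      using U by (auto simp: V_def delta_covers_def split: prod.split)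
    moreover have "(\<Union>i. A i) \<subseteq> (\<Union>k. V k)"
    proof
      fix x assume "x \<in> (\<Union>i. A i)"
      then obtain i where "x \<in> A i" by blast
      then obtain j where "x \<in> U i j"
        using U[of i] by (auto simp: delta_covers_def)
      then show "x \<in> (\<Union>k. V k)"
        using V_encode[of i j] by blast
    qed
    ultimately show ?thesis
      by (simp add: delta_covers_def)
  qed
  then have "hausdorff_premeasure s \<delta> (\<Union>i. A i) \<le> (\<Sum>k. gauge_term s (V k))"
    by (rule hausdorff_premeasure_le_suminf)
  also have "\<dots> = (\<Sum>i. \<Sum>j. gauge_term s (U i j))"
    using suminf_ennreal_2dimen[of "\<lambda>i. \<Sum>j. gauge_term s (U i j)" "\<lambda>(i, j). gauge_term s (U i j)"]
    by (simp add: V_def comp_def case_prod_unfold)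
  also have "\<dots> \<le> (\<Sum>i. ?h i + ?e i)"
    using sum_U by (intro suminf_le) (auto intro: less_imp_le)
  also have "\<dots> = (\<Sum>i. ?h i) + (\<Sum>i. ?e i)"
    by (simp add: suminf_add)
  also have "(\<Sum>i. ?e i) = ennreal e"
    using e sums_mult[OF power_half_series, of e] by (intro suminf_ennreal_eq) auto
  finally show "hausdorff_premeasure s \<delta> (\<Union>i. A i) \<le> (\<Sum>i. ?h i) + ennreal e" .
qed

lemma hausdorff_premeasure_Un_le:
  "hausdorff_premeasure s \<delta> (A \<union> B) \<le> hausdorff_premeasure s \<delta> A + hausdorff_premeasure s \<delta> B"
  using hausdorff_premeasure_UN_le[of s \<delta> "binaryset A B"]
  by (simp add: UN_binaryset_eq suminf_binaryset_eq)

lemma hausdorff_premeasure_finite_UN_le: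
  assumes "finite I"
  shows "hausdorff_premeasure s \<delta> (\<Union>i\<in>I. A i) \<le> (\<Sum>i\<in>I. hausdorff_premeasure s \<delta> (A i))"
  using assms
proof induction
  case (insert i I)
  have "hausdorff_premeasure s \<delta> (\<Union>i\<in>insert i I. A i)
      \<le> hausdorff_premeasure s \<delta> (A i) + hausdorff_premeasure s \<delta> (\<Union>i\<in>I. A i)"
    using hausdorff_premeasure_Un_le by simp
  with insert show ?case
    by (simp add: order.trans add_left_mono)
qed simp

lemma hausdorff_premeasure_countable:
  assumes "countable A" "A \<subseteq> M" "0 < s" "0 \<le> \<delta>"
  shows "hausdorff_premeasure s \<delta> A = 0"
proof (cases "A = {}")
  case False
  then have A: "A = (\<Union>i. {from_nat_into A i})"
    using assms(1) by (simp add: UNION_singleton_eq_range range_from_nat_into)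
  have "hausdorff_premeasure s \<delta> {x} = 0" if "x \<in> A" for x
    using hausdorff_premeasure_le_gauge_term[of "{x}" \<delta> s] that assms
    by (auto simp: diam_def gauge_term_def)
  then have "hausdorff_premeasure s \<delta> {from_nat_into A i} = 0" for i
    using False by (simp add: from_nat_into)
  then show ?thesis
    using hausdorff_premeasure_UN_le[of s \<delta> "\<lambda>i. {from_nat_into A i}"] A by simp
qed simp

text \<open>A covering sum below \<open>\<delta>' powr s\<close> forces every member of the cover to have diameter at most
  \<open>\<delta>'\<close>. So for positive exponents null sets can be recognised at a single scale.\<close>

lemma hausdorff_measure_eq_0_iff:
  assumes s: "0 < s" and \<delta>: "0 < \<delta>"
  shows "hausdorff_measure s A = 0 \<longleftrightarrow> hausdorff_premeasure s \<delta> A = 0"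
proof
  assume "hausdorff_measure s A = 0"
  moreover have "hausdorff_premeasure s \<delta> A \<le> hausdorff_measure s A"
    unfolding hausdorff_measure_def using \<delta> by (intro SUP_upper) simp
  ultimately show "hausdorff_premeasure s \<delta> A = 0"
    by simp
next
  assume null: "hausdorff_premeasure s \<delta> A = 0"
  have "hausdorff_premeasure s \<delta>' A \<le> 0" if \<delta>': "0 < \<delta>'" for \<delta>'
  proof (rule ennreal_le_epsilon)
    fix e :: real assume e: "0 < e"
    define \<epsilon> where "\<epsilon> = min e (\<delta>' powr s)"
    have "hausdorff_premeasure s \<delta> A < ennreal \<epsilon>"
      using null e \<delta>' by (simp add: \<epsilon>_def)
    then obtain U where U: "U \<in> delta_covers \<delta> A" and sum: "(\<Sum>i. gauge_term s (U i)) < ennreal \<epsilon>"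
      unfolding hausdorff_premeasure_def INF_less_iff by blast
    have "diam (U i) \<le> ennreal \<delta>'" for i
    proof (cases "U i = {}")
      case False
      have "diam (U i) \<noteq> top"
        using U by (metis (mono_tags, lifting) delta_covers_def ennreal_less_top leD mem_Collect_eq)
      then obtain r where r: "0 \<le> r" "diam (U i) = ennreal r"
        by (cases "diam (U i)" rule: ennreal_cases) auto
      have "gauge_term s (U i) < ennreal \<epsilon>"
        using sum by (rule ennreal_suminf_lessD)
      then have "ennreal (r powr s) < ennreal \<epsilon>"
        using False s r by (simp add: gauge_term_def)
      then have "r powr s < \<delta>' powr s"
        by (simp add: ennreal_less_iff \<epsilon>_def)
      then have "r < \<delta>'"
        using s \<delta>' r by (meson not_less powr_mono2 less_imp_le)
      then show ?thesis
        by (simp add: r ennreal_leI)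
    qed (simp add: diam_def)
    then have "U \<in> delta_covers \<delta>' A"
      using U by (simp add: delta_covers_def)
    then have "hausdorff_premeasure s \<delta>' A \<le> (\<Sum>i. gauge_term s (U i))"
      by (rule hausdorff_premeasure_le_suminf)
    also have "\<dots> \<le> ennreal e"
      using sum by (rule less_imp_le[THEN order.trans]) (simp add: \<epsilon>_def ennreal_leI)
    finally show "hausdorff_premeasure s \<delta>' A \<le> 0 + ennreal e"
      by simp
  qed
  then show "hausdorff_measure s A = 0"
    by (simp add: hausdorff_measure_def SUP_eq_const bot_ennreal)
qed

lemma hausdorff_dim_mono:
  assumes "A \<subseteq> B"
  shows "hausdorff_dim A \<le> hausdorff_dim B"
proof -
  have "hausdorff_measure s A \<le> hausdorff_measure s B" for s
    unfolding hausdorff_measure_def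
    by (intro SUP_mono') (rule hausdorff_premeasure_mono[OF assms])
  then have "hausdorff_measure s A = 0" if "hausdorff_measure s B = 0" for s
    using that by (metis le_zero_eq)
  then show ?thesis
    unfolding hausdorff_dim_def by (intro Inf_superset_mono) blast
qed

text \<open>Together, the next two lemmas replace comparisons of dimensions by comparisons of null sets
  at the single scale \<open>1\<close>, where covers need not be refined.\<close>

lemma hausdorff_dim_le:
  assumes "0 < s" "hausdorff_premeasure s 1 A = 0"
  shows "hausdorff_dim A \<le> ennreal s"
  unfolding hausdorff_dim_def
  using assms hausdorff_measure_eq_0_iff[of s 1 A] by (intro Inf_lower) auto

lemma hausdorff_premeasure_eq_0_above_dim:
  assumes "hausdorff_dim A < ennreal t"
  shows "hausdorff_premeasure t 1 A = 0"
proof -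
  obtain s where s: "0 \<le> s" "hausdorff_measure s A = 0" "ennreal s < ennreal t"
    using assms unfolding hausdorff_dim_def Inf_less_iff by blast
  have st: "s < t"
    using s by (simp add: ennreal_less_iff)
  have "hausdorff_premeasure s 1 A \<le> hausdorff_measure s A"
    unfolding hausdorff_measure_def by (intro SUP_upper) simp
  then have null: "hausdorff_premeasure s 1 A = 0"
    using s by simp
  have "gauge_term t U \<le> gauge_term s U" if "diam U \<le> ennreal 1" for U
  proof -
    have "enn2real (diam U) \<le> 1"
      using that by (metis enn2real_mono enn2real_1 ennreal_1 ennreal_one_less_top)
    then show ?thesis
      using s st by (auto simp: gauge_term_def powr_le1 intro!: ennreal_leI powr_mono')
  qed
  then have "hausdorff_premeasure t 1 A \<le> hausdorff_premeasure s 1 A"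
    unfolding hausdorff_premeasure_def
    by (intro INF_superset_mono order_refl suminf_le) (auto simp: delta_covers_def)
  with null show ?thesis
    by simp
qed

end


section \<open>Cylinders of the sequence space\<close>

lemma funpow_shift [simp]: "(shift ^^ n) x = (\<lambda>i. x (n + i))"
  by (induction n arbitrary: x) (simp_all add: shift_def funpow_Suc_right del: funpow.simps)

definition cylinder :: "nat \<Rightarrow> nat \<Rightarrow> symseq \<Rightarrow> symseq set" where
  "cylinder m n y = {x \<in> Seqs m. \<forall>i<n. x i = y i}"

locale sequence_space =
  fixes m :: nat
  assumes m: "1 \<le> m"

sublocale sequence_space \<subseteq> Metric_space "Seqs m" "seq_dist m"
  using m by (rule Metric_space_Seqs)

context sequence_space
begin

abbreviation q :: real where
  "q \<equiv> real m + 1"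

lemma seq_dist_le:
  assumes x: "x \<in> Seqs m" and y: "y \<in> Seqs m" and agree: "\<And>i. i < n \<Longrightarrow> x i = y i"
  shows "seq_dist m x y \<le> 1 / q ^ n"
proof -
  let ?f = "\<lambda>i. if i < n then 0 else real m / q ^ Suc i"
  have "(\<lambda>i. (1 / q) ^ i) sums (1 / (1 - 1 / q))"
    using m by (intro geometric_sums) simp
  then have "(\<lambda>i. (real m / q ^ Suc n) * (1 / q) ^ i) sums ((real m / q ^ Suc n) * (1 / (1 - 1 / q)))"
    by (rule sums_mult)
  moreover have "1 - 1 / q = real m / q"
    by (simp add: field_simps)
  then have "(real m / q ^ Suc n) * (1 / (1 - 1 / q)) = 1 / q ^ n"
    using m by simp
  moreover have "(\<lambda>i. (real m / q ^ Suc n) * (1 / q) ^ i) = (\<lambda>i. ?f (i + n))"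
    by (simp add: fun_eq_iff power_add field_simps)
  ultimately have "(\<lambda>i. ?f (i + n)) sums (1 / q ^ n)"
    by simp
  then have f: "?f sums (1 / q ^ n)"
    by (subst (asm) sums_iff_shift) simp
  show ?thesis
  proof (rule sums_le[OF _ seq_dist_sums[OF m x y] f])
    fix i
    have "x i \<le> m" "y i \<le> m"
      using x y by (auto simp: Seqs_def Pi_iff)
    then have "\<bar>real (x i) - real (y i)\<bar> \<le> real m"
      by linarith
    then show "\<bar>real (x i) - real (y i)\<bar> / q ^ Suc i \<le> ?f i"
      using agree by (auto intro: divide_right_mono)
  qed
qed

lemma seq_dist_ge:
  assumes x: "x \<in> Seqs m" and y: "y \<in> Seqs m" and "x j \<noteq> y j"
  shows "1 / q ^ Suc j \<le> seq_dist m x y"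
proof -
  let ?f = "\<lambda>i. \<bar>real (x i) - real (y i)\<bar> / q ^ Suc i"
  have "1 / q ^ Suc j \<le> ?f j"
    using assms(3) by (intro divide_right_mono) auto
  also have "\<dots> = sum ?f {j}"
    by simp
  also have "\<dots> \<le> suminf ?f"
    using seq_dist_summable[OF m x y] by (intro sum_le_suminf) auto
  also have "\<dots> = seq_dist m x y"
    using seq_dist_sums[OF m x y] by (simp add: sums_iff)
  finally show ?thesis .
qed

lemma diam_cylinder_le: "diam (cylinder m n y) \<le> ennreal (1 / q ^ n)"
  unfolding diam_def cylinder_def
  by (intro SUP_least ennreal_leI seq_dist_le) auto

lemma q_powr_minus: "(1 / q ^ n) powr s = q powr (- s * real n)"
proof -
  have "1 / q ^ n = q powr (- real n)"
    by (simp add: powr_minus powr_realpow divide_inverse)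
  then show ?thesis
    by (simp add: powr_powr mult.commute)
qed

lemma hausdorff_premeasure_cylinder_le:
  assumes "0 < s"
  shows "hausdorff_premeasure s 1 (cylinder m n y) \<le> ennreal (q powr (- s * real n))"
proof -
  have diam: "diam (cylinder m n y) \<le> ennreal (1 / q ^ n)"
    by (rule diam_cylinder_le)
  also have "\<dots> \<le> ennreal 1"
    by (intro ennreal_leI) simp
  finally have "hausdorff_premeasure s 1 (cylinder m n y) \<le> gauge_term s (cylinder m n y)"
    by (intro hausdorff_premeasure_le_gauge_term) (auto simp: cylinder_def)
  also have "\<dots> \<le> ennreal ((1 / q ^ n) powr s)"
  proof -
    have "enn2real (diam (cylinder m n y)) \<le> 1 / q ^ n"
      using diam by (intro enn2real_leI) auto
    then show ?thesis
      using assms by (auto simp: gauge_term_def intro!: ennreal_leI powr_mono2)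
  qed
  finally show ?thesis
    by (simp only: q_powr_minus)
qed

text \<open>A set \<open>U\<close> of positive diameter \<open>r\<close> lies in a cylinder whose length \<open>k\<close> satisfies
  \<open>q powr (- real k) \<le> q\<^sup>2 * r\<close>. So a bound for preimages of cylinders carries over to preimages
  of arbitrary sets, at the cost of the factor \<open>q powr (2 * s)\<close>.\<close>

lemma gauge_term_bounds_preimage:
  assumes s: "0 < s" and C: "0 \<le> C" and U: "U \<subseteq> Seqs m" "diam U \<le> ennreal 1"
    and \<Phi>: "\<And>y n. y \<in> Seqs m \<Longrightarrow>
      hausdorff_premeasure t 1 {x \<in> A. \<Phi> x \<in> cylinder m n y} \<le> ennreal (C * q powr (- s * real n))"
  shows "hausdorff_premeasure t 1 {x \<in> A. \<Phi> x \<in> U} \<le> ennreal (C * q powr (2 * s)) * gauge_term s U"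
proof (cases "U = {}")
  case False
  then obtain y where y: "y \<in> U" by blast
  have q1: "1 < q"
    using m by simp
  have bound: "hausdorff_premeasure t 1 {x \<in> A. \<Phi> x \<in> U} \<le> ennreal (C * q powr (- s * real n))"
    if "U \<subseteq> cylinder m n y" for n
  proof -
    have "{x \<in> A. \<Phi> x \<in> U} \<subseteq> {x \<in> A. \<Phi> x \<in> cylinder m n y}"
      using that by auto
    from hausdorff_premeasure_mono[OF this] show ?thesis
      by (rule order.trans) (use \<Phi> y U in auto)
  qed
  define r where "r = enn2real (diam U)"
  have r: "0 \<le> r" "r \<le> 1" "diam U = ennreal r"
    using U(2) le_less_trans[OF U(2) ennreal_less_top] by (simp_all add: r_def enn2real_leI)
  have dist_le: "seq_dist m y z \<le> r" if "z \<in> U" for z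
  proof -
    have "ennreal (seq_dist m y z) \<le> diam U"
      unfolding diam_def using y that by (intro SUP_upper2[of y] SUP_upper2[of z]) auto
    then show ?thesis
      by (simp add: r)
  qed
  have gauge: "gauge_term s U = ennreal (r powr s)"
    using False s by (simp add: gauge_term_def r_def)
  have subset_cylinder: "U \<subseteq> cylinder m (k - 1) y" if k: "r \<le> 1 / q ^ k" for k
  proof
    fix z assume z: "z \<in> U"
    have "z i = y i" if i: "i < k - 1" for i
    proof (rule ccontr)
      assume "z i \<noteq> y i"
      then have "1 / q ^ Suc i \<le> seq_dist m y z"
        using y z U by (intro seq_dist_ge) auto
      also have "\<dots> \<le> 1 / q ^ k"
        using dist_le[OF z] k by linarith
      finally have "q ^ k \<le> q ^ Suc i"
        using q1 by (simp add: field_simps del: power_Suc)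
      moreover have "q ^ Suc i < q ^ k"
        using q1 i by (intro power_strict_increasing) auto
      ultimately show False by simp
    qed
    then show "z \<in> cylinder m (k - 1) y"
      using z U by (auto simp: cylinder_def)
  qed
  have small: "\<exists>n. 1 / q ^ n < \<epsilon>" if "0 < \<epsilon>" for \<epsilon> :: real
    using real_arch_pow_inv[OF that, of "1 / q"] q1 by (simp add: power_one_over)
  show ?thesis
  \<comment> \<open>A set of diameter \<open>0\<close> lies in arbitrarily long cylinders, so its preimage is null.\<close>
  proof (cases "r = 0")
    case True
    have "hausdorff_premeasure t 1 {x \<in> A. \<Phi> x \<in> U} \<le> 0"
    proof (rule ennreal_le_epsilon)
      fix e :: real assume e: "0 < e"
      have "(\<lambda>n. C * (q powr (- s)) ^ n) \<longlonglongrightarrow> C * 0"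
        using powr_less_mono[of "- s" 0 q] q1 s by (intro tendsto_mult_left LIMSEQ_power_zero) simp
      then have "(\<lambda>n. C * q powr (- s * real n)) \<longlonglongrightarrow> C * 0"
        by (simp add: powr_powr flip: powr_realpow)
      then have "eventually (\<lambda>n. C * q powr (- s * real n) < e) sequentially"
        using e by (intro order_tendstoD) auto
      then obtain n where "C * q powr (- s * real n) < e"
        by (auto simp: eventually_sequentially)
      then have "ennreal (C * q powr (- s * real n)) \<le> ennreal e"
        by (intro ennreal_leI) simp
      moreover have "U \<subseteq> cylinder m n y"
        using subset_cylinder[of "Suc n"] True by simp
      ultimately show "hausdorff_premeasure t 1 {x \<in> A. \<Phi> x \<in> U} \<le> 0 + ennreal e"
        using bound[of n] by simp
    qed
    then show ?thesis by simp
  next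
    case False
    \<comment> \<open>The scale of \<open>U\<close>: by minimality, \<open>q powr (- real n) < r \<le> q powr (1 - real n)\<close>.\<close>
    define n where "n = (LEAST n. 1 / q ^ n < r)"
    have n: "1 / q ^ n < r"
      unfolding n_def by (rule LeastI_ex) (use small[of r] False r in simp)
    then obtain k where k: "n = Suc k"
      using r by (cases n) auto
    have rk: "r \<le> 1 / q ^ k"
      using not_less_Least[of k "\<lambda>n. 1 / q ^ n < r"] k by (simp add: n_def not_less)
    have "- s * real (k - 1) \<le> 2 * s + - s * real n"
    proof -
      have "s * (real n - 2) \<le> s * real (k - 1)"
        using s k by (intro mult_left_mono) auto
      then show ?thesis by (simp add: algebra_simps)
    qed
    then have "q powr (- s * real (k - 1)) \<le> q powr (2 * s + - s * real n)"
      using q1 by (intro powr_mono) auto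
    also have "\<dots> = q powr (2 * s) * (1 / q ^ n) powr s"
      by (simp only: q_powr_minus powr_add)
    also have "\<dots> \<le> q powr (2 * s) * r powr s"
      using n s by (intro mult_left_mono powr_mono2) auto
    finally have "C * q powr (- s * real (k - 1)) \<le> C * q powr (2 * s) * r powr s"
      using C by (simp add: mult_left_mono mult.assoc)
    then have "hausdorff_premeasure t 1 {x \<in> A. \<Phi> x \<in> U} \<le> ennreal (C * q powr (2 * s) * r powr s)"
      using bound[OF subset_cylinder[OF rk]] by (meson ennreal_leI order.trans)
    then show ?thesis
      using C by (simp add: gauge ennreal_mult)
  qed
qed simp

text \<open>A cover of \<open>B\<close> with a small \<open>s\<close>-dimensional sum pulls back along \<open>\<Phi>\<close> to a cover of \<open>A\<close> with
  a comparable \<open>t\<close>-dimensional sum. The map may be far from injective: what it identifies is paid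
  for by the difference \<open>t - s\<close> of the exponents.\<close>

lemma null_via_cylinder_preimages:
  assumes s: "0 < s" and C: "0 < C" and \<Phi>_in: "\<And>x. x \<in> A \<Longrightarrow> \<Phi> x \<in> B"
    and null: "hausdorff_premeasure s 1 B = 0"
    and \<Phi>: "\<And>y n. y \<in> Seqs m \<Longrightarrow>
      hausdorff_premeasure t 1 {x \<in> A. \<Phi> x \<in> cylinder m n y} \<le> ennreal (C * q powr (- s * real n))"
  shows "hausdorff_premeasure t 1 A = 0"
proof -
  let ?K = "C * q powr (2 * s)"
  have K: "0 < ?K"
    using C by simp
  have "hausdorff_premeasure t 1 A \<le> 0"
  proof (rule ennreal_le_epsilon)
    fix e :: real assume e: "0 < e"
    have "hausdorff_premeasure s 1 B < ennreal (e / ?K)"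
      using null e K by simp
    then obtain U where U: "U \<in> delta_covers 1 B"
      and sum: "(\<Sum>i. gauge_term s (U i)) < ennreal (e / ?K)"
      unfolding hausdorff_premeasure_def INF_less_iff by blast
    have "A \<subseteq> (\<Union>i. {x \<in> A. \<Phi> x \<in> U i})"
      using U \<Phi>_in by (fastforce simp: delta_covers_def)
    then have "hausdorff_premeasure t 1 A \<le> hausdorff_premeasure t 1 (\<Union>i. {x \<in> A. \<Phi> x \<in> U i})"
      by (rule hausdorff_premeasure_mono)
    also have "\<dots> \<le> (\<Sum>i. hausdorff_premeasure t 1 {x \<in> A. \<Phi> x \<in> U i})"
      by (rule hausdorff_premeasure_UN_le)
    also have "\<dots> \<le> (\<Sum>i. ennreal ?K * gauge_term s (U i))"
      using U s C \<Phi>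
      by (intro suminf_le gauge_term_bounds_preimage) (auto simp: delta_covers_def)
    also have "\<dots> \<le> ennreal ?K * ennreal (e / ?K)"
      using sum by (simp add: mult_left_mono)
    also have "\<dots> = ennreal e"
      using K e by (subst ennreal_mult[symmetric]) auto
    finally show "hausdorff_premeasure t 1 A \<le> 0 + ennreal e"
      by simp
  qed
  then show ?thesis by simp
qed

end

section \<open>Thinning out a sequence\<close>

text \<open>The first nonzero symbol of each aligned block of length \<open>N\<close> is erased. Erasing at fixed
  positions would not do: the supremum \<open>e\<close> of the introduction might vanish at all of these, and
  sequences could then approximate \<open>e\<close> without being changed.\<close>

definition thin :: "nat \<Rightarrow> symseq \<Rightarrow> symseq" where
  "thin N x i = (if \<forall>i'<i. i' div N = i div N \<longrightarrow> x i' = 0 then 0 else x i)"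

lemma thin_le: "thin N x i \<le> x i"
  by (simp add: thin_def)

lemma thin_fixes_only_zero_blocks:
  assumes "\<And>i. i div N = b \<Longrightarrow> thin N x i = x i" "i div N = b"
  shows "x i = 0"
  using assms(2)
proof (induction i rule: less_induct)
  case (less i)
  then have "thin N x i = 0"
    by (simp add: thin_def)
  with assms(1)[OF less.prems] show ?case by simp
qed

lemma thin_changes_one_symbol_per_block:
  assumes "0 < N"
  obtains r where "r < N" "\<And>i. i div N = b \<Longrightarrow> i mod N \<noteq> r \<Longrightarrow> x i = thin N x i"
proof (cases "\<exists>i. i div N = b \<and> x i \<noteq> 0")
  case False
  then show ?thesis
    using that[of 0] assms by (auto simp: thin_def)
next
  case True
  define a where "a = (LEAST i. i div N = b \<and> x i \<noteq> 0)"
  have a: "a div N = b" "x a \<noteq> 0"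
    using LeastI_ex[OF True] by (auto simp: a_def)
  have a_least: "x i = 0" if "i div N = b" "i < a" for i
    using not_less_Least[of i "\<lambda>i. i div N = b \<and> x i \<noteq> 0"] that by (auto simp: a_def)
  show ?thesis
  proof (rule that)
    show "a mod N < N"
      using assms by simp
    fix i assume i: "i div N = b" "i mod N \<noteq> a mod N"
    then consider "i < a" | "a < i"
      by (metis linorder_neqE_nat)
    then show "x i = thin N x i"
    proof cases
      case 1
      then show ?thesis
        using a_least i by (simp add: thin_def)
    next
      case 2
      then show ?thesis
        using a i by (auto simp: thin_def)
    qed
  qed
qed

text \<open>To recover \<open>x\<close> from \<open>thin N x\<close> on \<open>J\<close> blocks, one needs for each block the place of the erased
  symbol and its value. This leaves \<open>N * (m + 1)\<close> possibilities per block, hence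
  \<open>(N * (m + 1)) ^ J\<close> cylinders.\<close>

lemma (in sequence_space) hausdorff_premeasure_thin_preimage_le:
  assumes N: "0 < N" and t: "0 < t" and A: "A \<subseteq> Seqs m"
  shows "hausdorff_premeasure t 1 {x \<in> A. \<forall>i<N * J. thin N x i = y i}
      \<le> ennreal ((real N * q) ^ J * q powr (- t * real (N * J)))"
proof -
  \<comment> \<open>The choice \<open>f\<close> lists, for each block, a place and a value; \<open>rest f\<close> undoes the erasure.\<close>
  define F where "F = {..<J} \<rightarrow>\<^sub>E ({..<N} \<times> {..m})"
  define rest where
    "rest f i = (if i mod N = fst (f (i div N)) then snd (f (i div N)) else y i)" for f i
  have "finite F"
    unfolding F_def by (intro finite_PiE) auto
  have card_F: "real (card F) = (real N * q) ^ J"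
    by (simp add: F_def card_PiE algebra_simps)
  have "{x \<in> A. \<forall>i<N * J. thin N x i = y i} \<subseteq> (\<Union>f\<in>F. cylinder m (N * J) (rest f))"
  proof
    fix x assume x: "x \<in> {x \<in> A. \<forall>i<N * J. thin N x i = y i}"
    have xm: "x i \<le> m" for i
      using x A by (auto simp: Seqs_def Pi_iff)
    have "\<exists>r<N. \<forall>i. i div N = b \<longrightarrow> i mod N \<noteq> r \<longrightarrow> x i = thin N x i" for b
      using thin_changes_one_symbol_per_block[OF N, of b x] by metis
    then obtain r where r: "\<And>b. r b < N"
      and x_thin: "\<And>i. i mod N \<noteq> r (i div N) \<Longrightarrow> x i = thin N x i"
      by metis
    define f where "f = restrict (\<lambda>b. (r b, x (N * b + r b))) {..<J}"
    have "f \<in> F"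
      using r xm by (auto simp: F_def f_def)
    moreover have "x i = rest f i" if i: "i < N * J" for i
    proof (cases "i mod N = r (i div N)")
      case True
      then have "N * (i div N) + r (i div N) = i"
        by (metis mult_div_mod_eq)
      moreover have "i div N < J"
        using i by (simp add: less_mult_imp_div_less mult.commute)
      ultimately show ?thesis
        using True by (simp add: rest_def f_def)
    next
      case False
      moreover have "i div N < J"
        using i by (simp add: less_mult_imp_div_less mult.commute)
      ultimately show ?thesis
        using x x_thin[OF False] i by (simp add: rest_def f_def)
    qed
    ultimately show "x \<in> (\<Union>f\<in>F. cylinder m (N * J) (rest f))"
      using x A by (auto simp: cylinder_def)
  qed
  then have "hausdorff_premeasure t 1 {x \<in> A. \<forall>i<N * J. thin N x i = y i}
      \<le> hausdorff_premeasure t 1 (\<Union>f\<in>F. cylinder m (N * J) (rest f))"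
    by (rule hausdorff_premeasure_mono)
  also have "\<dots> \<le> (\<Sum>f\<in>F. hausdorff_premeasure t 1 (cylinder m (N * J) (rest f)))"
    using \<open>finite F\<close> by (rule hausdorff_premeasure_finite_UN_le)
  also have "\<dots> \<le> (\<Sum>f\<in>F. ennreal (q powr (- t * real (N * J))))"
    using t by (intro sum_mono hausdorff_premeasure_cylinder_le)
  also have "\<dots> = ennreal (real (card F) * q powr (- t * real (N * J)))"
    by (simp add: ennreal_mult ennreal_of_nat_eq_real_of_nat)
  finally show ?thesis
    by (simp only: card_F)
qed


text \<open>The premise on \<open>N\<close> says that the gain \<open>q powr ((t - s) * N)\<close> from raising the exponent outweighs
  the \<open>N * q\<close> ways to undo the thinning of one block. The prefix and the incomplete last block shorten
  cylinders by at most \<open>P + N\<close> symbols, which only costs a constant factor.\<close>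

lemma (in sequence_space) null_via_thinning_behind_prefix:
  assumes s: "0 < s" "s < t" and N: "0 < N" "real N * q \<le> q powr ((t - s) * real N)"
    and A: "A \<subseteq> Seqs m" and null: "hausdorff_premeasure s 1 B = 0"
    and in_B: "\<And>x. x \<in> A \<Longrightarrow> (\<lambda>i. if i < P then p i else thin N x (i - P)) \<in> B"
  shows "hausdorff_premeasure t 1 A = 0"
proof (rule null_via_cylinder_preimages[OF s(1) _ in_B null])
  let ?\<Phi> = "\<lambda>x i. if i < P then p i else thin N x (i - P)"
  have q1: "1 < q"
    using m by simp
  show "0 < q powr (s * real (P + N))"
    using q1 by simp
  fix y :: symseq and n :: nat
  define J where "J = (n - P) div N"
  have "N * J \<le> n - P"
    by (simp add: J_def)
  have long: "n \<le> N * J + P + N"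
    using N(1) mult_div_mod_eq[of N "n - P"] mod_less_divisor[of N "n - P"] unfolding J_def by linarith
  have "{x \<in> A. ?\<Phi> x \<in> cylinder m n y} \<subseteq> {x \<in> A. \<forall>i<N * J. thin N x i = y (P + i)}"
  proof (intro subsetI CollectI conjI allI impI; elim CollectE conjE)
    fix x i assume x: "?\<Phi> x \<in> cylinder m n y" and i: "i < N * J"
    have "P + i < n"
      using i \<open>N * J \<le> n - P\<close> by simp
    then have "?\<Phi> x (P + i) = y (P + i)"
      using x unfolding cylinder_def by blast
    then show "thin N x i = y (P + i)"
      by simp
  qed
  then have "hausdorff_premeasure t 1 {x \<in> A. ?\<Phi> x \<in> cylinder m n y}
      \<le> hausdorff_premeasure t 1 {x \<in> A. \<forall>i<N * J. thin N x i = y (P + i)}"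
    by (rule hausdorff_premeasure_mono)
  also have "\<dots> \<le> ennreal ((real N * q) ^ J * q powr (- t * real (N * J)))"
    using s by (intro hausdorff_premeasure_thin_preimage_le[OF N(1) _ A]) simp
  also have "\<dots> \<le> ennreal (q powr (s * real (P + N)) * q powr (- s * real n))"
  proof (rule ennreal_leI)
    have "(real N * q) ^ J \<le> (q powr ((t - s) * real N)) ^ J"
      using N q1 by (intro power_mono) auto
    also have "\<dots> = q powr ((t - s) * real (N * J))"
      by (simp add: powr_powr mult.assoc flip: powr_realpow)
    finally have "(real N * q) ^ J * q powr (- t * real (N * J))
        \<le> q powr ((t - s) * real (N * J)) * q powr (- t * real (N * J))"
      by (rule mult_right_mono) simp
    also have "\<dots> = q powr (- s * real (N * J))"
      by (simp only: powr_add[symmetric]) (simp add: algebra_simps)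
    also have "\<dots> \<le> q powr (s * real (P + N) + - s * real n)"
    proof (rule powr_mono)
      have "s * real n \<le> s * real (N * J + P + N)"
        using s long by (intro mult_left_mono of_nat_mono) auto
      then show "- s * real (N * J) \<le> s * real (P + N) + - s * real n"
        by (simp add: algebra_simps)
    qed (use q1 in simp)
    finally show "(real N * q) ^ J * q powr (- t * real (N * J))
        \<le> q powr (s * real (P + N)) * q powr (- s * real n)"
      by (simp only: powr_add)
  qed
  finally show "hausdorff_premeasure t 1 {x \<in> A. ?\<Phi> x \<in> cylinder m n y}
      \<le> ennreal (q powr (s * real (P + N)) * q powr (- s * real n))" .
qed

section \<open>Lexicographic suprema\<close>

text \<open>The supremum is found symbol by symbol, each being as large as possible after the choice of the
  previous ones. The slice consists of the sequences that follow these choices for \<open>k\<close> symbols.\<close>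

primrec greedy_slice :: "symseq set \<Rightarrow> nat \<Rightarrow> symseq set" where
  "greedy_slice A 0 = A"
| "greedy_slice A (Suc k) =
    {x \<in> greedy_slice A k. x k = Max ((\<lambda>x. x k) ` greedy_slice A k)}"

definition lex_sup :: "symseq set \<Rightarrow> symseq" where
  "lex_sup A k = Max ((\<lambda>x. x k) ` greedy_slice A k)"

lemma greedy_slice_eq: "greedy_slice A k = {x \<in> A. \<forall>i<k. x i = lex_sup A i}"
  by (induction k) (auto simp: lex_sup_def less_Suc_eq)

context
  fixes m :: nat and A :: "symseq set"
  assumes A: "A \<subseteq> Seqs m"
begin

lemma finite_symbols: "finite ((\<lambda>x. x k) ` B)" if "B \<subseteq> A" for B
proof (rule finite_subset)
  show "(\<lambda>x. x k) ` B \<subseteq> {0..m}"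
    using A that by (auto simp: Seqs_def Pi_iff)
qed simp

lemma greedy_slice_subset: "greedy_slice A k \<subseteq> A"
  by (auto simp: greedy_slice_eq)

lemma lex_le_lex_sup:
  assumes "x \<in> A"
  shows "lex_le x (lex_sup A)"
proof (cases "x = lex_sup A")
  case False
  then obtain k where k: "x k \<noteq> lex_sup A k" "\<And>i. i < k \<Longrightarrow> x i = lex_sup A i"
    using exists_least_iff[of "\<lambda>k. x k \<noteq> lex_sup A k"] by blast
  then have "x \<in> greedy_slice A k"
    using assms by (simp add: greedy_slice_eq)
  then have "x k \<le> lex_sup A k"
    unfolding lex_sup_def using finite_symbols[OF greedy_slice_subset] by (intro Max_ge) auto
  then have "less_fun x (lex_sup A)"
    using k by (intro less_funI exI[of _ k]) auto
  then show ?thesis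
    by (simp add: lex_le_def)
qed (simp add: lex_le_def)

lemma lex_sup_approximated:
  assumes "A \<noteq> {}"
  obtains x where "x \<in> A" "\<And>i. i < k \<Longrightarrow> x i = lex_sup A i"
proof -
  have "greedy_slice A k \<noteq> {}"
  proof (induction k)
    case (Suc k)
    then have "lex_sup A k \<in> (\<lambda>x. x k) ` greedy_slice A k"
      unfolding lex_sup_def using finite_symbols[OF greedy_slice_subset] by (intro Max_in) auto
    then show ?case
      by (auto simp: lex_sup_def)
  qed (use assms in simp)
  then show ?thesis
    using that by (auto simp: greedy_slice_eq)
qed

end

text \<open>At a first disagreement before \<open>k\<close>, the lexicographic order would make \<open>x\<close> the smaller one.\<close>

lemma lex_le_agree_if_pointwise_ge:
  assumes "lex_le x y" "\<And>i. i < k \<Longrightarrow> y i \<le> x i" "i < k"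
  shows "x i = y i"
proof (cases "x = y")
  case False
  then obtain j where j: "x j < y j" "\<And>j'. j' < j \<Longrightarrow> x j' = y j'"
    using assms(1) by (auto simp: lex_le_def less_fun_def)
  then have "k \<le> j"
    using assms(2)[of j] by (meson leD leI)
  then show ?thesis
    using j assms(3) by simp
qed simp

lemma lex_le_head:
  assumes "lex_le x y"
  shows "x 0 \<le> y 0"
proof (cases "x = y")
  case False
  then obtain k where "x k < y k" "\<And>i. i < k \<Longrightarrow> x i = y i"
    using assms by (auto simp: lex_le_def less_fun_def)
  then show ?thesis
    by (cases "k = 0") auto
qed simp

lemma less_fun_prefix_mono:
  fixes f g :: symseq
  assumes "\<And>i. i < k \<Longrightarrow> f i \<le> g i" "\<exists>i<k. f i < g i"
  shows "less_fun f g"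
proof -
  obtain i where i: "i < k" "f i < g i" "\<And>j. j < i \<Longrightarrow> \<not> (j < k \<and> f j < g j)"
    using assms(2) exists_least_iff[of "\<lambda>i. i < k \<and> f i < g i"] by blast
  then have "f j = g j" if "j < i" for j
    using that assms(1)[of j] by (metis le_neq_implies_less less_trans)
  with i show ?thesis
    by (intro less_funI) blast
qed


section \<open>Sequences all of whose shifts are smaller than a bound\<close>

definition shifts_below :: "nat \<Rightarrow> symseq \<Rightarrow> symseq set" where
  "shifts_below m c = {x \<in> Seqs m. \<forall>n. less_fun ((shift ^^ n) x) c}"

lemma shifts_below_subset_Seqs: "shifts_below m c \<subseteq> Seqs m"
  by (auto simp: shifts_below_def)

lemma shifts_below_le:
  assumes "x \<in> shifts_below m c"
  shows "x i \<le> m"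
  using assms by (auto simp: shifts_below_def Seqs_def Pi_iff)

lemma shift_mem_shifts_below:
  assumes "x \<in> shifts_below m c"
  shows "(\<lambda>i. x (n + i)) \<in> shifts_below m c"
  using assms by (auto simp: shifts_below_def Seqs_def Pi_iff simp flip: add.assoc)

text \<open>Such a sequence is \<open>c\<close> with a finite word in front, and there are countably many words.\<close>

lemma countable_eventual_preimages: "countable {x. \<exists>n. (shift ^^ n) x = c}"
proof (rule countable_subset)
  show "{x. \<exists>n. (shift ^^ n) x = c}
      \<subseteq> range (\<lambda>w i. if i < length w then w ! i else c (i - length w))"
  proof
    fix x assume "x \<in> {x. \<exists>n. (shift ^^ n) x = c}"
    then obtain n where n: "(shift ^^ n) x = c"
      by blast
    have "x = (\<lambda>i. if i < length (map x [0..<n]) then map x [0..<n] ! i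
        else c (i - length (map x [0..<n])))"
      by (auto simp: fun_eq_iff simp flip: n)
    then show "x \<in> range (\<lambda>w i. if i < length w then w ! i else c (i - length w))"
      by (rule range_eqI)
  qed
qed simp

lemma M_prime_subset: "M_prime m c \<subseteq> shifts_below m c \<union> {x \<in> Seqs m. \<exists>n. (shift ^^ n) x = c}"
  by (auto simp: M_prime_def shifts_below_def lex_le_def)

lemma M_strict_subset_M_prime: "M_strict m c \<subseteq> M_prime m c"
proof
  fix x assume x: "x \<in> M_strict m c"
  then have "lex_le x c" "\<And>n. 0 < n \<Longrightarrow> less_fun ((shift ^^ n) x) x"
    by (auto simp: M_strict_def)
  then have "lex_le ((shift ^^ n) x) c" for n
    by (cases "n = 0") (auto simp: lex_le_def dest: less_fun_trans)
  then show "x \<in> M_prime m c"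
    using x by (simp add: M_prime_def M_strict_def)
qed

context
  fixes m :: nat and c :: symseq and e :: symseq
  assumes nonzero: "\<exists>x\<in>shifts_below m c. \<exists>i. x i \<noteq> 0"
  defines "e \<equiv> lex_sup (shifts_below m c)"
begin

lemma le_sup: "x \<in> shifts_below m c \<Longrightarrow> lex_le x e"
  unfolding e_def by (rule lex_le_lex_sup[OF shifts_below_subset_Seqs])

lemma sup_approximated:
  obtains x where "x \<in> shifts_below m c" "\<And>i. i < k \<Longrightarrow> x i = e i"
  using lex_sup_approximated[OF shifts_below_subset_Seqs, of m c k] nonzero
  unfolding e_def by blast

lemma sup_in_Seqs: "e \<in> Seqs m"
proof -
  have "e i \<le> m" for i
  proof -
    obtain x where "x \<in> shifts_below m c" "x i = e i"
      using sup_approximated[of "Suc i"] by blast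
    then show ?thesis
      using shifts_below_le by metis
  qed
  then show ?thesis
    by (simp add: Seqs_def Pi_iff)
qed

lemma sup_head_pos: "0 < e 0"
proof -
  obtain x n where x: "x \<in> shifts_below m c" and n: "x n \<noteq> 0"
    using nonzero by blast
  have "lex_le (\<lambda>i. x (n + i)) e"
    using shift_mem_shifts_below[OF x] by (rule le_sup)
  then have "x n \<le> e 0"
    using lex_le_head by fastforce
  with n show ?thesis by simp
qed

text \<open>A supremum that vanishes from some place on would be attained: a member that agrees with it on
  its support cannot be smaller and so equals it. But then \<open>e\<close> can be restarted after a long run of
  its zeros. The result \<open>w\<close> is larger than \<open>e\<close>. It is still a member, because each
  comparison of a shift of \<open>e\<close> with \<open>c\<close> is decided after finitely many symbols, and so before the
  restart if the run of zeros is long enough.\<close>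

lemma sup_infinite_support: "\<exists>i\<ge>k. e i \<noteq> 0"
proof (rule ccontr)
  assume "\<not> (\<exists>i\<ge>k. e i \<noteq> 0)"
  then have zero: "e i = 0" if "k \<le> i" for i
    using that by blast
  obtain x where x: "x \<in> shifts_below m c" "\<And>i. i < k \<Longrightarrow> x i = e i"
    using sup_approximated by blast
  have "x = e"
  proof
    fix i
    show "x i = e i"
      by (rule lex_le_agree_if_pointwise_ge[OF le_sup[OF x(1)], of "Suc i"])
        (metis x(2) zero le0 not_less order_refl, simp)
  qed
  with x have e_mem: "e \<in> shifts_below m c"
    by simp
  have "\<exists>j. e (n + j) < c j \<and> (\<forall>j'<j. e (n + j') = c j')" for n
    using e_mem by (auto simp: shifts_below_def less_fun_def)
  then obtain d where d: "\<And>n. e (n + d n) < c (d n)" "\<And>n j. j < d n \<Longrightarrow> e (n + j) = c j"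
    by metis
  \<comment> \<open>The shift by \<open>n\<close> falls below \<open>c\<close> at index \<open>d n\<close>, which for \<open>n < k\<close> is read before position \<open>L\<close>.\<close>
  define L where "L = Suc (k + (\<Sum>n<k. n + d n))"
  have L: "n + d n < L" if "n < k" for n
    using member_le_sum[of n "{..<k}" "\<lambda>n. n + d n"] that by (simp add: L_def)
  define w where "w i = (if i < L then e i else e (i - L))" for i
  have c0: "0 < c 0"
    using sup_head_pos d[of 0] by (cases "d 0 = 0") auto
  have "less_fun (\<lambda>i. w (n + i)) c" for n
  proof -
    consider "L \<le> n" | "k \<le> n" "n < L" | "n < k"
      by linarith
    then show ?thesis
    proof cases
      case 1
      then have "(\<lambda>i. w (n + i)) = (\<lambda>i. e (n - L + i))"
        by (simp add: w_def fun_eq_iff)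
      then show ?thesis
        using d(1)[of "n - L"] d(2)[of _ "n - L"] by (auto simp: less_fun_def)
    next
      case 2
      then show ?thesis
        using c0 zero by (intro less_funI exI[of _ 0]) (simp add: w_def)
    next
      case 3
      then show ?thesis
        using d(1)[of n] d(2)[of _ n] L[of n] by (intro less_funI exI[of _ "d n"]) (auto simp: w_def)
    qed
  qed
  moreover have "w \<in> Seqs m"
    using sup_in_Seqs by (auto simp: w_def Seqs_def Pi_iff)
  ultimately have "lex_le w e"
    by (intro le_sup) (simp add: shifts_below_def)
  moreover have "less_fun e w"
    using sup_head_pos zero[of L] by (intro less_funI exI[of _ L]) (auto simp: w_def L_def)
  ultimately show False
    by (auto simp: lex_le_def less_fun_irrefl dest: less_fun_asym)
qed

text \<open>The gap: the length \<open>K\<close> is uniform in \<open>x\<close> and \<open>n\<close>. If a shift of \<open>thin N x\<close> agreed with \<open>e\<close>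
  for \<open>K\<close> symbols, then \<open>x\<close>, squeezed between its thinning and \<open>e\<close>, would do so too. Thinning would
  change nothing in this range, and so \<open>x\<close> would vanish on the blocks inside it, among them one that
  meets a nonzero symbol of \<open>e\<close>.\<close>

lemma thin_shifts_below_sup:
  assumes "0 < N"
  obtains K where "\<And>x n. x \<in> shifts_below m c \<Longrightarrow>
    \<exists>j<K. thin N x (n + j) < e j \<and> (\<forall>i<j. thin N x (n + i) = e i)"
proof -
  \<comment> \<open>Since \<open>N \<le> i0\<close>, the aligned block that contains \<open>n + i0\<close> starts after \<open>n\<close>, whatever \<open>n\<close> is.\<close>
  obtain i0 where i0: "N \<le> i0" "e i0 \<noteq> 0"
    using sup_infinite_support by blast
  show ?thesis
  proof (rule that[of "i0 + N"])
    fix x n assume x: "x \<in> shifts_below m c"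
    let ?z = "\<lambda>i. x (n + i)"
    let ?z' = "\<lambda>i. thin N x (n + i)"
    have z: "lex_le ?z e"
      using shift_mem_shifts_below[OF x] by (rule le_sup)
    have "\<exists>i<i0 + N. ?z' i \<noteq> e i"
    proof (rule ccontr)
      assume "\<not> (\<exists>i<i0 + N. ?z' i \<noteq> e i)"
      then have z': "?z' i = e i" if "i < i0 + N" for i
        using that by blast
      have zz': "?z i = ?z' i" if i: "i < i0 + N" for i
        using lex_le_agree_if_pointwise_ge[OF z, of "i0 + N" i] z' thin_le[of N x] i
        by metis
      have "thin N x i = x i" if i: "i div N = (n + i0) div N" for i
      proof -
        have "N * (i div N) \<le> i" "i < N + N * (i div N)"
          "N * ((n + i0) div N) \<le> n + i0" "n + i0 < N + N * ((n + i0) div N)"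
          using assms by (simp_all add: dividend_less_times_div)
        then have "n \<le> i" "i < n + i0 + N"
          using i0(1) unfolding i by linarith+
        then show ?thesis
          using zz'[of "i - n"] by simp
      qed
      then have "x (n + i0) = 0"
        using thin_fixes_only_zero_blocks[of N "(n + i0) div N" x "n + i0"] by blast
      then show False
        using z'[of i0] zz'[of i0] i0 assms by simp
    qed
    then obtain j where j: "j < i0 + N" "?z' j \<noteq> e j" "\<And>i. i < j \<Longrightarrow> ?z' i = e i"
      using exists_least_iff[of "\<lambda>i. i < i0 + N \<and> ?z' i \<noteq> e i"] by (metis less_trans)
    have "?z' j < e j"
    proof (rule ccontr)
      assume "\<not> ?z' j < e j"
      then have le: "e i \<le> ?z i" if "i < Suc j" for i
        using that j(3) thin_le[of N x "n + i"] by (metis less_antisym not_less order.trans order_refl)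
      then have "?z j = e j"
        using lex_le_agree_if_pointwise_ge[OF z le] by blast
      then show False
        using \<open>\<not> ?z' j < e j\<close> j(2) thin_le[of N x "n + j"] by simp
    qed
    with j show "\<exists>j<i0 + N. ?z' j < e j \<and> (\<forall>i<j. ?z' i = e i)"
      by blast
  qed
qed

text \<open>Let \<open>y\<close> consist of \<open>K\<close> symbols of \<open>e\<close>, then zeros up to position \<open>P\<close>, then \<open>thin N x\<close>. Shifts that
  start in the last part are below \<open>y\<close> by the gap, and those that start in the zeros because \<open>e\<close> does
  not begin with \<open>0\<close>. A shift by \<open>n < K\<close> begins with a suffix of the prefix of \<open>e\<close>, which is at most
  the prefix itself; in case of a tie, zeros are compared with the last \<open>n\<close> symbols of the prefix, and
  the last symbol is nonzero. Finally \<open>y\<close> is below \<open>c\<close> because \<open>e\<close> has a nonzero symbol at a position \<open>l\<close>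
  where \<open>y\<close> has a zero.\<close>

lemma thin_behind_prefix_in_M_strict:
  assumes "0 < N"
  obtains P p where "\<And>x. x \<in> shifts_below m c \<Longrightarrow>
    (\<lambda>i. if i < P then p i else thin N x (i - P)) \<in> M_strict m c"
proof -
  obtain K0 where K0: "\<And>x n. x \<in> shifts_below m c \<Longrightarrow>
      \<exists>j<K0. thin N x (n + j) < e j \<and> (\<forall>i<j. thin N x (n + i) = e i)"
    using thin_shifts_below_sup[OF assms] by blast
  obtain k where k: "K0 \<le> k" "e k \<noteq> 0"
    using sup_infinite_support by blast
  define K where "K = Suc k"
  obtain l where l: "K \<le> l" "e l \<noteq> 0"
    using sup_infinite_support by blast
  \<comment> \<open>The zeros reach beyond \<open>l\<close>, and they are at least as many as the \<open>K\<close> symbols before them.\<close>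
  define P where "P = l + K"
  define p where "p i = (if i < K then e i else 0)" for i
  show ?thesis
  proof (rule that[of P p])
    fix x assume x: "x \<in> shifts_below m c"
    define y where "y i = (if i < P then p i else thin N x (i - P))" for i
    have y_prefix: "y i = e i" if "i < K" for i
      using that by (simp add: y_def p_def P_def)
    have y_zeros: "y i = 0" if "K \<le> i" "i < P" for i
      using that by (simp add: y_def p_def)
    have "y \<in> Seqs m"
    proof -
      have "thin N x i \<le> m" for i
        using thin_le[of N x i] shifts_below_le[OF x, of i] by simp
      then show ?thesis
        using sup_in_Seqs by (auto simp: y_def p_def Seqs_def Pi_iff)
    qed
    moreover have "less_fun y c"
    proof -
      \<comment> \<open>The supremum itself may fail to be below \<open>c\<close>, hence the detour over a member that agrees with it.\<close>
      obtain x' where x': "x' \<in> shifts_below m c" "\<And>i. i < P \<Longrightarrow> x' i = e i"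
        using sup_approximated by blast
      have "less_fun y x'"
      proof (rule less_fun_prefix_mono[of P])
        show "y i \<le> x' i" if "i < P" for i
          using that x' y_prefix y_zeros by (cases "i < K") auto
        show "\<exists>i<P. y i < x' i"
          using l x' y_zeros by (intro exI[of _ l]) (auto simp: P_def K_def)
      qed
      moreover have "less_fun x' c"
        using x'(1) by (auto simp: shifts_below_def dest: spec[of _ 0])
      ultimately show ?thesis
        by (rule less_fun_trans)
    qed
    moreover have "less_fun (\<lambda>i. y (n + i)) y" if n: "0 < n" for n
    proof -
      consider "P \<le> n" | "K \<le> n" "n < P" | "n < K"
        by linarith
      then show ?thesis
      proof cases
        case 1
        then have "y (n + i) = thin N x (n - P + i)" for i
          by (simp add: y_def)
        moreover obtain j where "j < K0" "thin N x (n - P + j) < e j"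
          "\<And>i. i < j \<Longrightarrow> thin N x (n - P + i) = e i"
          using K0[OF x, of "n - P"] by blast
        ultimately show ?thesis
          using k y_prefix by (intro less_funI exI[of _ j]) (auto simp: K_def)
      next
        case 2
        then show ?thesis
          using y_zeros[of n] y_prefix[of 0] sup_head_pos
          by (intro less_funI exI[of _ 0]) (auto simp: K_def)
      next
        case 3
        obtain x' where x': "x' \<in> shifts_below m c" "\<And>i. i < K \<Longrightarrow> x' i = e i"
          using sup_approximated by blast
        have border: "lex_le (\<lambda>i. x' (n + i)) e"
          using shift_mem_shifts_below[OF x'(1)] by (rule le_sup)
        have y_x': "y (n + i) = x' (n + i)" if "i < K - n" for i
          using that x' y_prefix by simp
        show ?thesis
        proof (cases "\<forall>i<K - n. x' (n + i) = e i")
          case True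
          show ?thesis
          proof (rule less_fun_prefix_mono[of K])
            show "y (n + i) \<le> y i" if "i < K" for i
              using that True y_x' y_prefix y_zeros[of "n + i"] 3 l
              by (cases "i < K - n") (auto simp: P_def)
            have "y (n + k) = 0"
              using n 3 l by (intro y_zeros) (auto simp: K_def P_def)
            then show "\<exists>i<K. y (n + i) < y i"
              using k y_prefix[of k] by (intro exI[of _ k]) (auto simp: K_def)
          qed
        next
          case False
          then obtain j where "x' (n + j) < e j" "\<And>i. i < j \<Longrightarrow> x' (n + i) = e i"
            using border by (auto simp: lex_le_def less_fun_def fun_eq_iff)
          moreover from this False have "j < K - n"
            by (meson le_less_trans not_less)
          ultimately show ?thesis
            using y_x' y_prefix by (intro less_funI exI[of _ j]) auto
        qed
      qed
    qed
    ultimately have "y \<in> M_strict m c"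
      by (simp add: M_strict_def lex_le_def)
    then show "(\<lambda>i. if i < P then p i else thin N x (i - P)) \<in> M_strict m c"
      by (simp add: y_def[abs_def])
  qed
qed

end

section \<open>Equality of the dimensions\<close>

context sequence_space
begin

text \<open>Exponential growth beats linear growth: thinning costs a factor linear in \<open>N\<close> per block, which a
  positive gain \<open>t - s\<close> in the exponent makes up for once blocks are long.\<close>

lemma ex_block_length:
  assumes "s < t"
  obtains N where "0 < N" "real N * q \<le> q powr ((t - s) * real N)"
proof -
  have q1: "1 < q"
    using m by simp
  define a where "a = q powr (t - s)"
  have a: "1 < a"
    using powr_less_mono[of 0 "t - s" q] assms q1 by (simp add: a_def)
  have "(\<lambda>N. of_nat N * (1 / a) ^ N) \<longlonglongrightarrow> 0"
    using a by (intro powser_times_n_limit_0) simp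
  then have "\<forall>\<^sub>F N in sequentially. of_nat N * (1 / a) ^ N < 1 / q"
    using q1 by (intro order_tendstoD(2)) auto
  then obtain N where N: "0 < N" "of_nat N * (1 / a) ^ N < 1 / q"
    using eventually_conj[OF eventually_gt_at_top[of 0]] by (metis (mono_tags, lifting) eventually_happens trivial_limit_sequentially)
  then have "real N * q < a ^ N"
    using a q1 by (simp add: power_one_over field_simps)
  also have "a ^ N = q powr ((t - s) * real N)"
    using q1 by (simp add: a_def powr_powr flip: powr_realpow)
  finally show ?thesis
    using that N(1) by simp
qed

lemma null_shifts_below_if_null_M_strict:
  assumes s: "0 < s" "s < t" and null: "hausdorff_premeasure s 1 (M_strict m c) = 0"
  shows "hausdorff_premeasure t 1 (shifts_below m c) = 0"
proof (cases "\<exists>x\<in>shifts_below m c. \<exists>i. x i \<noteq> 0")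
  case True
  obtain N where N: "0 < N" "real N * q \<le> q powr ((t - s) * real N)"
    using ex_block_length[OF s(2)] by blast
  obtain P p where "\<And>x. x \<in> shifts_below m c \<Longrightarrow>
      (\<lambda>i. if i < P then p i else thin N x (i - P)) \<in> M_strict m c"
    using thin_behind_prefix_in_M_strict[OF True N(1)] by blast
  then show ?thesis
    by (rule null_via_thinning_behind_prefix[OF s N shifts_below_subset_Seqs null])
next
  case False
  then have "shifts_below m c \<subseteq> {\<lambda>_. 0}"
    by (auto simp: fun_eq_iff)
  then have "countable (shifts_below m c)"
    by (rule countable_subset) simp
  then show ?thesis
    using s by (intro hausdorff_premeasure_countable shifts_below_subset_Seqs) auto
qed

lemma hausdorff_dim_M_prime_le: "hausdorff_dim (M_prime m c) \<le> hausdorff_dim (M_strict m c)"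
proof (rule dense_ge)
  fix z assume z: "hausdorff_dim (M_strict m c) < z"
  show "hausdorff_dim (M_prime m c) \<le> z"
  proof (cases z rule: ennreal_cases)
    case (real t)
    obtain z' where z': "hausdorff_dim (M_strict m c) < z'" "z' < z"
      using dense[OF z] by blast
    obtain s where s: "0 \<le> s" "z' = ennreal s"
      using z'(2) by (cases z' rule: ennreal_cases) auto
    have st: "s < t"
      using z'(2) s real by (simp add: ennreal_less_iff)
    have "0 < s"
      using z'(1) s by (metis ennreal_less_zero_iff le_zero_eq not_less zero_le)
    let ?Z = "{x \<in> Seqs m. \<exists>n. (shift ^^ n) x = c}"
    have "hausdorff_premeasure s 1 (M_strict m c) = 0"
      using z'(1) s by (simp add: hausdorff_premeasure_eq_0_above_dim)
    then have "hausdorff_premeasure t 1 (shifts_below m c) = 0"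
      using \<open>0 < s\<close> st by (intro null_shifts_below_if_null_M_strict)
    moreover have "hausdorff_premeasure t 1 ?Z = 0"
      using \<open>0 < s\<close> st
      by (intro hausdorff_premeasure_countable countable_subset[OF _ countable_eventual_preimages[of c]]) auto
    ultimately have "hausdorff_premeasure t 1 (shifts_below m c \<union> ?Z) = 0"
      using hausdorff_premeasure_Un_le[of t 1 "shifts_below m c" ?Z] by simp
    then have "hausdorff_premeasure t 1 (M_prime m c) = 0"
      using hausdorff_premeasure_mono[OF M_prime_subset, of t 1 m c] by simp
    then show ?thesis
      using \<open>0 < s\<close> st real by (simp add: hausdorff_dim_le)
  qed simp
qed

end

theorem proposition4:
  fixes m :: nat and c :: "nat \<Rightarrow> nat"
  assumes "m \<ge> 1" and "c \<in> Seqs m"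
  shows "dimH m (M_strict m c) = dimH m (M_prime m c)"
proof -
  interpret sequence_space m
    using assms(1) by unfold_locales
  show ?thesis
    unfolding dimH_def
    by (intro antisym hausdorff_dim_M_prime_le hausdorff_dim_mono M_strict_subset_M_prime)
qed

end
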